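(* Consider the Hermitian metric $$g=\frac1h\,dx^2+h(x)\,\theta\otimes\theta+\sum_{j=1}^mA_j(x)\,\pi_j^*g_j^*$$ described in the context, and its scalar curvature equation $$S=-h''-h'\Big(\sum_{j=1}^md_j\frac{A_j'}{A_j}\Big)+h\Big[-\sum_{j=1}^md_j\frac{A_j''}{A_j}+\frac34\sum_{j=1}^md_j\Big(\frac{A_j'}{A_j}\Big)^2-\frac14\Big(\sum_{j=1}^md_j\frac{A_j'}{A_j}\Big)^2-\sum_{j=1}^m\frac{d_j}{4}\frac{b_j^2}{A_j^2}\Big]+\sum_{j=1}^m\frac{d_j}{A_j}.$$ This equation is satisfied for $$h=\frac{1}{\prod_{j=1}^mA_j^{d_j/2}}\int\Big[\int\Big(\sum_{j=1}^m\frac{d_j}{A_j}-S\Big)\prod_{j=1}^mA_j^{d_j/2}\,dx\Big]dx$$ if and only if $$\sum_{j=1}^md_j\Big[2\frac{A_j''}{A_j}-\Big(\frac{A_j'}{A_j}\Big)^2+\frac{b_j^2}{A_j^2}\Big]=0.$$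
   Context: $(M_j,g_j^* )$, $1\le j\le m$, are Kähler–Einstein manifolds of real dimension $d_j$ with Einstein constant $1$ and Kähler forms $\omega_j^*$; $P$ is a principal $S^1$-bundle over $M_1\times\dots\times M_m$, $\theta$ a connection form on $P$ with $d\theta=\sum_jb_j\pi_j^*\omega_j^*$ ($b_j$ constants), and $\pi_j:P\to M_j$ the projections. The metric $g$ is defined on $P\times I$, $I\subset\mathbb R$ an open interval with coordinate $x$, where $h>0$ and $A_j>0$ are smooth functions of $x$, and $'=\frac{d}{dx}$. It is Hermitian with respect to the complex structure $J$ which maps the $x$-direction to the direction of the vector field $\partial_\phi$ dual to $\theta$ and restricts to the lifts of the complex structures of the $M_j$. $S=S(x)$ is the scalar curvature. The iterated indefinite integral is understood with some choice of the two constants of integration. *)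

theory Defs
  imports "HOL-Analysis.Analysis"
begin

text \<open>
  For an open set \<open>I\<close>, the iterates of \<^const>\<open>deriv\<close> depend near a point of \<open>I\<close> only on the
  values of \<open>f\<close> on \<open>I\<close>, so the values of \<open>f\<close> outside \<open>I\<close> are irrelevant here.
\<close>

definition smooth_on_open :: "real set \<Rightarrow> (real \<Rightarrow> real) \<Rightarrow> bool" where
  "smooth_on_open I f \<longleftrightarrow> (\<forall>n. \<forall>x\<in>I. (deriv ^^ n) f field_differentiable at x)"

text \<open>
  \<open>indefinite_integral_on I f F\<close>: on the open interval \<open>I\<close>, \<open>F\<close> is the indefinite integral of \<open>f\<close>
  for some choice of the constant of integration.
\<close>

definition indefinite_integral_on ::
    "real set \<Rightarrow> (real \<Rightarrow> real) \<Rightarrow> (real \<Rightarrow> real) \<Rightarrow> bool" where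
  "indefinite_integral_on I f F \<longleftrightarrow> (\<forall>x\<in>I. (F has_real_derivative f x) (at x))"

end

theory Submission
  imports Defs
begin

text \<open>
  Put \<open>P = (\<Prod>j. A\<^sub>j powr (d\<^sub>j / 2))\<close> and \<open>L = (\<Sum>j. d\<^sub>j A\<^sub>j' / A\<^sub>j)\<close>, so that \<open>P' = P L / 2\<close>. The
  integral formula for \<open>h\<close> says \<open>(h P)'' = (T - S) P\<close> with \<open>T = (\<Sum>j. d\<^sub>j / A\<^sub>j)\<close>; dividing by \<open>P\<close>
  gives \<open>T - S = h'' + h' L + h (L' / 2 + L\<^sup>2 / 4)\<close>. Subtracting this from the curvature equation
  leaves \<open>-h / 4\<close> times the sum in the stated criterion, at each point separately, and \<open>h > 0\<close>.
\<close>

lemma smooth_on_open_DERIV: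
  assumes "smooth_on_open I f" "x \<in> I"
  shows "(f has_real_derivative deriv f x) (at x)"
    and "(deriv f has_real_derivative deriv (deriv f) x) (at x)"
proof -
  have "(deriv ^^ n) f field_differentiable at x" for n
    using assms by (simp add: smooth_on_open_def)
  from this[of 0] this[of 1]
  show "(f has_real_derivative deriv f x) (at x)"
    "(deriv f has_real_derivative deriv (deriv f) x) (at x)"
    by (simp_all add: DERIV_deriv_iff_field_differentiable)
qed

text \<open>Logarithmic differentiation: the factor \<open>f i x powr c i\<close> has logarithmic
  derivative \<open>c i * (f' i / f i x)\<close>, and these add up over a product. Positivity makes
  the powers differentiable and keeps every factor nonzero.\<close>

lemma DERIV_prod_powr:
  fixes f :: "'i \<Rightarrow> real \<Rightarrow> real"
  assumes "\<And>i. i \<in> J \<Longrightarrow> (f i has_real_derivative f' i) (at x)"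
    and "\<And>i. i \<in> J \<Longrightarrow> 0 < f i x"
  shows "((\<lambda>x. \<Prod>i\<in>J. f i x powr c i) has_real_derivative
    (\<Prod>i\<in>J. f i x powr c i) * (\<Sum>i\<in>J. c i * (f' i / f i x))) (at x)"
proof -
  have "((\<lambda>x. f i x powr c i) has_real_derivative
      f i x powr c i * (c i * (f' i / f i x))) (at x)" if "i \<in> J" for i
    using assms[OF that]
    by (auto intro!: derivative_eq_intros simp: powr_diff field_simps)
  then have "((\<lambda>x. \<Prod>i\<in>J. f i x powr c i) has_real_derivative
      (\<Prod>i\<in>J. f i x powr c i) *
      (\<Sum>i\<in>J. (f i x powr c i * (c i * (f' i / f i x))) / f i x powr c i)) (at x)"
    using assms(2) by (intro has_field_derivative_prod') (auto simp: less_imp_neq[symmetric])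
  also have "(\<Sum>i\<in>J. (f i x powr c i * (c i * (f' i / f i x))) / f i x powr c i) =
      (\<Sum>i\<in>J. c i * (f' i / f i x))"
    using assms(2) by (intro sum.cong) (force simp: field_simps)+
  finally show ?thesis .
qed

text \<open>Termwise \<open>(f'/f)' = f''/f - (f'/f)\<^sup>2\<close>. The two parts are kept as
  separate sums because the curvature equation weights them differently.\<close>

lemma DERIV_weighted_log_derivative_sum:
  fixes f f' :: "'i \<Rightarrow> real \<Rightarrow> real"
  assumes "\<And>i. i \<in> J \<Longrightarrow> (f i has_real_derivative f' i x) (at x)"
    and "\<And>i. i \<in> J \<Longrightarrow> (f' i has_real_derivative f'' i) (at x)"
    and "\<And>i. i \<in> J \<Longrightarrow> f i x \<noteq> 0"
  shows "((\<lambda>x. \<Sum>i\<in>J. c i * (f' i x / f i x)) has_real_derivative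
    (\<Sum>i\<in>J. c i * (f'' i / f i x)) - (\<Sum>i\<in>J. c i * (f' i x / f i x)\<^sup>2)) (at x)"
  unfolding sum_subtractf[symmetric]
proof (rule DERIV_sum)
  fix i assume i: "i \<in> J"
  show "((\<lambda>x. c i * (f' i x / f i x)) has_real_derivative
      c i * (f'' i / f i x) - c i * (f' i x / f i x)\<^sup>2) (at x)"
    by (rule derivative_eq_intros assms i refl)+
      (use assms(3)[OF i] in \<open>simp add: field_simps power2_eq_square\<close>)
qed

text \<open>As \<open>P' = P * l\<close>, each differentiation of \<open>h * P\<close> leaves the
  factor \<open>P\<close> intact: \<open>(h P)' = (h' + h l) P\<close>, and repeating this yields
  the bracket. \<open>F\<close> and \<open>G\<close> are known only as successive antiderivatives,
  so they enter through uniqueness of derivatives.\<close>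

lemma second_DERIV_mult_log_derivative:
  fixes h h' P l F G :: "real \<Rightarrow> real"
  assumes "open I" "x \<in> I"
    and F: "\<And>y. y \<in> I \<Longrightarrow> F y = h y * P y"
    and dF: "\<And>y. y \<in> I \<Longrightarrow> (F has_real_derivative G y) (at y)"
    and dG: "(G has_real_derivative g) (at x)"
    and h: "\<And>y. y \<in> I \<Longrightarrow> (h has_real_derivative h' y) (at y)"
    and h': "(h' has_real_derivative h'') (at x)"
    and P: "\<And>y. y \<in> I \<Longrightarrow> (P has_real_derivative P y * l y) (at y)"
    and l: "(l has_real_derivative l') (at x)"
  shows "g = (h'' + 2 * h' x * l x + h x * (l' + (l x)\<^sup>2)) * P x"
proof -
  \<comment> \<open>The formula for \<open>G\<close> is needed on all of \<open>I\<close>, not just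
    at \<open>x\<close>, since it is differentiated again below. Agreement of \<open>F\<close> with
    \<open>h * P\<close> on the open set \<open>I\<close> suffices for this.\<close>
  have G: "G y = (h' y + h y * l y) * P y" if "y \<in> I" for y
  proof -
    have "((\<lambda>y. h y * P y) has_real_derivative (h' y + h y * l y) * P y) (at y)"
      by (rule derivative_eq_intros h P that)+ (simp add: algebra_simps)
    then have "(F has_real_derivative (h' y + h y * l y) * P y) (at y)"
      using \<open>open I\<close> that by (rule has_field_derivative_transform_within_open) (simp add: F)
    with dF[OF that] show ?thesis by (rule DERIV_unique)
  qed
  have "((\<lambda>y. (h' y + h y * l y) * P y) has_real_derivative
      (h'' + 2 * h' x * l x + h x * (l' + (l x)\<^sup>2)) * P x) (at x)"
    by (rule derivative_eq_intros h h' P l \<open>x \<in> I\<close> refl)+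
      (simp add: algebra_simps power2_eq_square)
  then have "(G has_real_derivative
      (h'' + 2 * h' x * l x + h x * (l' + (l x)\<^sup>2)) * P x) (at x)"
    using \<open>open I\<close> \<open>x \<in> I\<close>
    by (rule has_field_derivative_transform_within_open) (simp add: G)
  with dG show ?thesis by (rule DERIV_unique)
qed

theorem theorem10p2:
  fixes m :: nat
    and d :: "nat \<Rightarrow> nat"
    and b :: "nat \<Rightarrow> real"
    and A :: "nat \<Rightarrow> real \<Rightarrow> real"
    and h S :: "real \<Rightarrow> real"
    and I :: "real set"
  assumes "open I" and "is_interval I"
    and "\<And>j. j \<in> {1..m} \<Longrightarrow> even (d j) \<and> 0 < d j"
    and "\<And>j. j \<in> {1..m} \<Longrightarrow> smooth_on_open I (A j)"
    and "\<And>j x. j \<in> {1..m} \<Longrightarrow> x \<in> I \<Longrightarrow> 0 < A j x"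
    and "smooth_on_open I h"
    and "\<And>x. x \<in> I \<Longrightarrow> 0 < h x"
    and "\<exists>G F.
      indefinite_integral_on I
        (\<lambda>x. ((\<Sum>j=1..m. real (d j) / A j x) - S x)
              * (\<Prod>j=1..m. A j x powr (real (d j) / 2))) G
      \<and> indefinite_integral_on I G F
      \<and> (\<forall>x\<in>I. h x = 1 / (\<Prod>j=1..m. A j x powr (real (d j) / 2)) * F x)"
  shows "(\<forall>x\<in>I. S x =
        - deriv (deriv h) x
        - deriv h x * (\<Sum>j=1..m. real (d j) * (deriv (A j) x / A j x))
        + h x * (- (\<Sum>j=1..m. real (d j) * (deriv (deriv (A j)) x / A j x))
                 + 3 / 4 * (\<Sum>j=1..m. real (d j) * (deriv (A j) x / A j x)\<^sup>2)
                 - 1 / 4 * (\<Sum>j=1..m. real (d j) * (deriv (A j) x / A j x))\<^sup>2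
                 - (\<Sum>j=1..m. real (d j) / 4 * ((b j)\<^sup>2 / (A j x)\<^sup>2)))
        + (\<Sum>j=1..m. real (d j) / A j x))
    \<longleftrightarrow>
    (\<forall>x\<in>I. (\<Sum>j=1..m. real (d j) *
        (2 * (deriv (deriv (A j)) x / A j x) - (deriv (A j) x / A j x)\<^sup>2
          + (b j)\<^sup>2 / (A j x)\<^sup>2)) = 0)"
proof -
  define P where "P x = (\<Prod>j=1..m. A j x powr (real (d j) / 2))" for x
  define L where "L x = (\<Sum>j=1..m. real (d j) * (deriv (A j) x / A j x))" for x
  define Q where "Q x = (\<Sum>j=1..m. real (d j) * (deriv (deriv (A j)) x / A j x))" for x
  define R where "R x = (\<Sum>j=1..m. real (d j) * (deriv (A j) x / A j x)\<^sup>2)" for x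
  define T where "T x = (\<Sum>j=1..m. real (d j) / A j x)" for x
  define B where "B x = (\<Sum>j=1..m. real (d j) * ((b j)\<^sup>2 / (A j x)\<^sup>2))" for x
  have P_pos: "P x > 0" if "x \<in> I" for x
    unfolding P_def by (rule prod_pos) (use assms(5) that in force)
  obtain G F where
    dG: "\<And>x. x \<in> I \<Longrightarrow> (G has_real_derivative (T x - S x) * P x) (at x)" and
    dF: "\<And>x. x \<in> I \<Longrightarrow> (F has_real_derivative G x) (at x)" and
    h: "\<And>x. x \<in> I \<Longrightarrow> h x = 1 / P x * F x"
    using assms(8) unfolding indefinite_integral_on_def P_def T_def by blast
  have F: "F x = h x * P x" if "x \<in> I" for x
    using h[OF that] P_pos[OF that] by simp
  \<comment> \<open>The exponents \<open>d j / 2\<close> give \<open>P\<close> the logarithmic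
    derivative \<open>L / 2\<close>, so that the cross term \<open>2 * h' * (L / 2)\<close> is
    exactly the \<open>h' * L\<close> of the curvature equation.\<close>
  have dP: "(P has_real_derivative P x * (L x / 2)) (at x)" if "x \<in> I" for x
    using DERIV_prod_powr[of "{1..m}" A "\<lambda>j. deriv (A j) x" x "\<lambda>j. real (d j) / 2"]
      smooth_on_open_DERIV(1)[OF assms(4) that] assms(5)[OF _ that]
    by (simp add: P_def[abs_def] L_def sum_divide_distrib mult.commute[of 2])
  have dL: "((\<lambda>x. L x / 2) has_real_derivative (Q x - R x) / 2) (at x)" if "x \<in> I" for x
    unfolding L_def Q_def R_def
    by (intro DERIV_cdivide DERIV_weighted_log_derivative_sum)
      (use smooth_on_open_DERIV[OF assms(4) that] assms(5)[OF _ that] in force)+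
  have T_S: "T x - S x =
      deriv (deriv h) x + deriv h x * L x + h x * ((Q x - R x) / 2 + (L x)\<^sup>2 / 4)"
    if "x \<in> I" for x
  proof -
    have "(T x - S x) * P x = (deriv (deriv h) x + 2 * deriv h x * (L x / 2)
        + h x * ((Q x - R x) / 2 + (L x / 2)\<^sup>2)) * P x"
      by (rule second_DERIV_mult_log_derivative[where I = I and F = F and G = G])
        (use assms(1) that F dF dG dP dL smooth_on_open_DERIV[OF assms(6)] in auto)
    then show ?thesis
      using P_pos[OF that] by (simp add: power_divide)
  qed
  \<comment> \<open>From here all sums are expressed through \<open>L\<close>, \<open>Q\<close>,
    \<open>R\<close>, \<open>T\<close>, \<open>B\<close>, which reduces the claim to algebra at a
    single point.\<close>
  have B4: "(\<Sum>j=1..m. real (d j) / 4 * ((b j)\<^sup>2 / (A j x)\<^sup>2)) = B x / 4" for x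
    by (simp add: B_def sum_divide_distrib mult.commute[of 4])
  have crit: "(\<Sum>j=1..m. real (d j) *
      (2 * (deriv (deriv (A j)) x / A j x) - (deriv (A j) x / A j x)\<^sup>2
        + (b j)\<^sup>2 / (A j x)\<^sup>2)) = 2 * Q x - R x + B x" for x
    unfolding Q_def R_def B_def
    by (simp add: sum_distrib_left ring_distribs sum.distrib sum_subtractf mult.left_commute)
  have "S x = - deriv (deriv h) x - deriv h x * L x
        + h x * (- Q x + 3 / 4 * R x - 1 / 4 * (L x)\<^sup>2 - B x / 4) + T x
      \<longleftrightarrow> 2 * Q x - R x + B x = 0" if "x \<in> I" for x
  proof -
    \<comment> \<open>Substituting \<open>T_S\<close> cancels the terms in \<open>h''\<close>,
      \<open>h'\<close> and \<open>L\<^sup>2\<close>; the coefficients left on \<open>h\<close> are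
      \<open>-1 + 1/2 = -1/2\<close> for \<open>Q\<close>, \<open>3/4 - 1/2 = 1/4\<close> for
      \<open>R\<close> and \<open>-1/4\<close> for \<open>B\<close>.\<close>
    have "- deriv (deriv h) x - deriv h x * L x
        + h x * (- Q x + 3 / 4 * R x - 1 / 4 * (L x)\<^sup>2 - B x / 4) + T x - S x
      = - (h x / 4) * (2 * Q x - R x + B x)"
      using T_S[OF that] by (simp add: field_simps)
    then show ?thesis
      using assms(7)[OF that] by (auto simp: eq_commute[of "S x"] eq_iff_diff_eq_0[of _ "S x"])
  qed
  then show ?thesis
    unfolding crit B4 by (simp add: L_def Q_def R_def T_def)
qed

end
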